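(* Let $d, k, \ell \in \mathbb{N}$ and let $\{F_1, \ldots, F_\ell\} \subset \mathcal{P}_f(\mathbb{N})$ with $F_i = \{a_{i1}, \ldots, a_{id}\}$ for all $i \in \{1, \ldots, \ell\}$. Then for any $k$-coloring of $\mathbb{N}$, there exist $b, c \in \mathbb{N}$ such that the set $$\left\{\left|\Sigma_{< s_b\, s_{a_{i1}}^{c}\, s_{a_{i2}}^{c^2} \cdots s_{a_{id}}^{c^d}}\right| : i = 1, \ldots, \ell\right\}$$ is monochromatic.
   Context: $\mathbb{N}_0$ denotes the nonnegative integers and $\mathbb{N}$ the positive integers. $\mathcal{P}_f(\mathbb{N})$ is the set of all finite nonempty subsets of $\mathbb{N}$. $\Sigma = \{u^2+v^2 : u,v \in \mathbb{N}_0\}$ is the set of sums of two squares, which is closed under multiplication; it is enumerated increasingly as $\Sigma = \{s_0 < s_1 < s_2 < \cdots\}$ (so $s_0=0$, $s_1=1$, $s_2=2$, $s_3=4$, $s_4=5,\dots$). For $s \in \Sigma$, $\Sigma_{<s} = \{y \in \Sigma : y < s\}$. In the product, the factor $s_{a_{ij}}$ is raised to the power $c^j$, for the given enumeration $a_{i1},\dots,a_{id}$ of $F_i$. A set is monochromatic if it is contained in a single color class. *)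

theory Defs
  imports Complex_Main "HOL-Library.Infinite_Set" "HOL-Library.FuncSet"
begin

definition Pf :: "nat set set" where
  "Pf = {F. F \<subseteq> {1..} \<and> finite F \<and> F \<noteq> {}}"

definition sums_two_squares :: "nat set" where
  "sums_two_squares = {u^2 + v^2 | u v. True}"

text \<open>The increasing enumeration starts at index 0, so its first terms are 0, 1, 2, 4, 5.
  The library function \<^const>\<open>enumerate\<close> is the increasing enumeration only for infinite
  sets; see \<open>infinite_sums_two_squares\<close> below.\<close>

definition sq_seq :: "nat \<Rightarrow> nat" where
  "sq_seq n = enumerate sums_two_squares n"

definition sums_two_squares_below :: "nat \<Rightarrow> nat set" where
  "sums_two_squares_below s = {y \<in> sums_two_squares. y < s}"

text \<open>A coloring of the positive integers with colors \<open>1, \<dots>, k\<close>; the value at 0 is irrelevant.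
  Colors may be left unused.\<close>

definition coloring :: "nat \<Rightarrow> (nat \<Rightarrow> nat) \<Rightarrow> bool" where
  "coloring k \<chi> \<longleftrightarrow> \<chi> \<in> {1..} \<rightarrow> {1..k}"

definition color_class :: "(nat \<Rightarrow> nat) \<Rightarrow> nat \<Rightarrow> nat set" where
  "color_class \<chi> q = {n \<in> {1..}. \<chi> n = q}"

definition monochromatic :: "nat \<Rightarrow> (nat \<Rightarrow> nat) \<Rightarrow> nat set \<Rightarrow> bool" where
  "monochromatic k \<chi> A \<longleftrightarrow> (\<exists>q\<in>{1..k}. A \<subseteq> color_class \<chi> q)"

lemma infinite_sums_two_squares: "infinite sums_two_squares"
proof -
  have "inj (\<lambda>u::nat. u^2)"
    by (simp add: inj_on_def)
  then have "infinite (range (\<lambda>u::nat. u^2))"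
    by (simp add: finite_image_iff)
  moreover have "range (\<lambda>u::nat. u^2) \<subseteq> sums_two_squares"
  proof
    fix y assume "y \<in> range (\<lambda>u::nat. u^2)"
    then obtain u :: nat where "y = u^2 + 0^2" by auto
    then show "y \<in> sums_two_squares" unfolding sums_two_squares_def by blast
  qed
  ultimately show ?thesis using finite_subset by blast
qed

lemma strict_mono_sq_seq: "strict_mono sq_seq"
  using strict_mono_enumerate[OF infinite_sums_two_squares]
  by (simp add: sq_seq_def[abs_def])

lemma range_sq_seq: "range sq_seq = sums_two_squares"
  using range_enumerate[OF infinite_sums_two_squares]
  by (simp add: sq_seq_def[abs_def])

end

theory Submission
  imports Defs "HOL-Library.Multiset" "HOL-Library.Function_Algebras"
begin

text \<open>
  Passing from a factor $s_u$ to the unit vector at $u$ turns products of powers of the $s_u$ into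
  vectors of exponents, and the factors $\prod_j s_{a_{ij}}^{c^j}$ into polynomial maps in $c$ that
  vanish at $0$. Pulling the coloring back along $x \mapsto |\Sigma_{<x}|$ colors
  the exponent vectors, and the claim becomes the polynomial van der Waerden theorem in an abelian
  group. That theorem is proved by Walters' color focusing argument, with induction
  on the multiset of degrees of the leading terms that occur. It is needed in a finitary form, so
  that the finitely many vectors involved can be translated to have nonnegative entries.
\<close>

section \<open>Polynomial maps described by differences\<close>

text \<open>The polynomial maps of degree at most \<open>e\<close>, described by iterated differences so that no
  coefficients are needed: two maps of degree \<open>Suc e\<close> have the same leading term iff they differ
  by an element of \<open>poly_maps e\<close>.\<close>

primrec poly_maps :: "nat \<Rightarrow> (nat \<Rightarrow> 'a::ab_group_add) set" where
  "poly_maps 0 = range (\<lambda>c _. c)"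
| "poly_maps (Suc e) = {p. \<forall>h. (\<lambda>n. p (n + h) - p n) \<in> poly_maps e}"

lemma poly_maps_const: "(\<lambda>_. c) \<in> poly_maps e"
  by (induction e arbitrary: c) auto

lemma poly_maps_diff:
  "p \<in> poly_maps e \<Longrightarrow> q \<in> poly_maps e \<Longrightarrow> (\<lambda>n. p n - q n) \<in> poly_maps e"
proof (induction e arbitrary: p q)
  case (Suc e)
  have "(\<lambda>n. (p (n + h) - p n) - (q (n + h) - q n)) \<in> poly_maps e" for h
    by (rule Suc.IH) (use Suc.prems in auto)
  moreover have "(\<lambda>n. (p (n + h) - p n) - (q (n + h) - q n))
      = (\<lambda>n. (p (n + h) - q (n + h)) - (p n - q n))" for h
    by (simp add: algebra_simps)
  ultimately show ?case by simp
qed auto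

lemma poly_maps_add:
  assumes "p \<in> poly_maps e" "q \<in> poly_maps e"
  shows "(\<lambda>n. p n + q n) \<in> poly_maps e"
  using poly_maps_diff[OF assms(1) poly_maps_diff[OF poly_maps_const[of 0] assms(2)]] by simp

lemma poly_maps_increment: "p \<in> poly_maps (Suc e) \<Longrightarrow> (\<lambda>n. p (n + h) - p n) \<in> poly_maps e"
  by simp

lemma poly_maps_Suc: "p \<in> poly_maps e \<Longrightarrow> p \<in> poly_maps (Suc e)"
proof (induction e arbitrary: p)
  case 0
  then show ?case by auto
next
  case (Suc e)
  have "(\<lambda>n. p (n + h) - p n) \<in> poly_maps (Suc e)" for h
    by (rule Suc.IH, rule poly_maps_increment, rule Suc.prems)
  then show ?case unfolding poly_maps.simps(2)[of "Suc e"] by blast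
qed

lemma poly_maps_mono: "p \<in> poly_maps e \<Longrightarrow> e \<le> e' \<Longrightarrow> p \<in> poly_maps e'"
  by (induction e' rule: nat_induct) (auto simp del: poly_maps.simps simp: le_Suc_eq poly_maps_Suc)

lemma poly_maps_shift: "p \<in> poly_maps e \<Longrightarrow> (\<lambda>n. p (n + h)) \<in> poly_maps e"
  using poly_maps_add[OF poly_maps_increment[OF poly_maps_Suc], of p e p h] by simp

text \<open>The discrete product rule writes the difference with step \<open>h\<close> as
  \<open>n * (q (n + h) - q n) + h * q (n + h)\<close>; the first summand is covered by
  induction.\<close>

lemma poly_maps_times:
  fixes q :: "nat \<Rightarrow> 'a::ring_1"
  shows "q \<in> poly_maps e \<Longrightarrow> (\<lambda>n. of_nat n * q n) \<in> poly_maps (Suc e)"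
proof (induction e arbitrary: q)
  case 0
  then obtain c where "q = (\<lambda>_. c)" by auto
  then have "(\<lambda>n. of_nat (n + h) * q (n + h) - of_nat n * q n) = (\<lambda>_. of_nat h * c)" for h
    by (simp add: algebra_simps)
  then show ?case by simp
next
  case (Suc e)
  have "(\<lambda>n. of_nat n * (q (n + h) - q n) + of_nat h * q (n + h)) \<in> poly_maps (Suc e)" for h
  proof (rule poly_maps_add)
    show "(\<lambda>n. of_nat n * (q (n + h) - q n)) \<in> poly_maps (Suc e)"
      by (intro Suc.IH poly_maps_increment Suc.prems)
    \<comment> \<open>A natural multiple is a repeated sum, so closure under addition
      suffices.\<close>
    have *: "(\<lambda>n. of_nat m * q (n + h)) \<in> poly_maps (Suc e)" for m
    proof (induction m)
      case 0
      show ?case using poly_maps_const[of 0 "Suc e"] by (simp del: poly_maps.simps)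
    next
      case (Suc m)
      show ?case
        using poly_maps_add[OF poly_maps_shift[OF \<open>q \<in> poly_maps (Suc e)\<close>, of h] Suc]
        by (simp del: poly_maps.simps add: algebra_simps)
    qed
    show "(\<lambda>n. of_nat h * q (n + h)) \<in> poly_maps (Suc e)" by (rule *)
  qed
  moreover have "(\<lambda>n. of_nat n * (q (n + h) - q n) + of_nat h * q (n + h))
      = (\<lambda>n. of_nat (n + h) * q (n + h) - of_nat n * q n)" for h
    by (simp add: algebra_simps)
  ultimately show ?case by (subst poly_maps.simps) (simp del: poly_maps.simps)
qed

lemma poly_maps_monomial:
  fixes g :: "'a::ring_1"
  shows "(\<lambda>n. of_nat n ^ j * g) \<in> poly_maps j"
proof (induction j)
  case (Suc j)
  show ?case using poly_maps_times[OF Suc] by (simp del: poly_maps.simps add: mult.assoc)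
qed simp

lemma poly_maps_sum:
  "(\<And>j. j \<in> J \<Longrightarrow> P j \<in> poly_maps e) \<Longrightarrow> (\<lambda>n. \<Sum>j\<in>J. P j n) \<in> poly_maps e"
  by (induction J rule: infinite_finite_induct) (simp_all add: poly_maps_const poly_maps_add)

section \<open>Partition regularity in finite form\<close>

text \<open>\<open>d = 0\<close> is excluded, since for maps vanishing at 0 it would give a trivial
  pattern.\<close>

definition has_pattern ::
  "'a set \<Rightarrow> nat \<Rightarrow> (nat \<Rightarrow> 'a::ab_group_add) set \<Rightarrow> ('a \<Rightarrow> nat) \<Rightarrow> bool" where
  "has_pattern S N A f \<longleftrightarrow>
    (\<exists>a\<in>S. \<exists>d\<in>{1..N}. \<forall>p\<in>A. a + p d \<in> S \<and> f (a + p d) = f a)"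

text \<open>\<open>S\<close> and \<open>N\<close> are chosen before the coloring, so a coloring may
  be built from them.\<close>

definition partition_regular :: "(nat \<Rightarrow> 'a::ab_group_add) set \<Rightarrow> bool" where
  "partition_regular A \<longleftrightarrow>
    (\<forall>k. \<exists>S N. finite S \<and> (\<forall>f. (\<forall>x. f x < k) \<longrightarrow> has_pattern S N A f))"

text \<open>Each color in \<open>C\<close> is the color of a pattern whose base point \<open>a\<close> would complete it; once \<open>C\<close>
  contains all colors, the color of \<open>a\<close> itself gives a contradiction.\<close>

definition focused ::
  "'a set \<Rightarrow> nat \<Rightarrow> (nat \<Rightarrow> 'a::ab_group_add) set \<Rightarrow> ('a \<Rightarrow> nat) \<Rightarrow> 'a \<Rightarrow> nat set \<Rightarrow> bool" where
  "focused S N A f a C \<longleftrightarrow> a \<in> S \<and> f a \<notin> C \<and>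
    (\<forall>c\<in>C. \<exists>d\<in>{1..N}. \<forall>p\<in>A. a + p d \<in> S \<and> f (a + p d) = c)"

text \<open>The zero map only repeats the base point. In the exhaustion it arises from classes of
  degree 1, below which there is no class to hold it.\<close>

lemma partition_regular_insert_zero:
  assumes "partition_regular (A - {\<lambda>_. 0})"
  shows "partition_regular A"
proof -
  have *: "has_pattern S N A f" if "has_pattern S N (A - {\<lambda>_. 0}) f" for S N f
  proof -
    from that obtain a d where *: "a \<in> S" "d \<in> {1..N}"
      "\<forall>p\<in>A - {\<lambda>_. 0}. a + p d \<in> S \<and> f (a + p d) = f a"
      unfolding has_pattern_def by blast
    have "a + p d \<in> S \<and> f (a + p d) = f a" if "p \<in> A" for p
      using * that by (cases "p = (\<lambda>_. 0)") simp_all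
    with *(1,2) show ?thesis unfolding has_pattern_def by blast
  qed
  show ?thesis
    unfolding partition_regular_def
  proof
    fix k
    obtain S N where "finite S" "\<forall>f. (\<forall>x. f x < k) \<longrightarrow> has_pattern S N (A - {\<lambda>_. 0}) f"
      using assms unfolding partition_regular_def by metis
    with * show "\<exists>S N. finite S \<and> (\<forall>f. (\<forall>x. f x < k) \<longrightarrow> has_pattern S N A f)" by metis
  qed
qed

lemma partition_regular_empty: "partition_regular {}"
proof -
  have "has_pattern {0} 1 {} f" for f :: "'a \<Rightarrow> nat"
    by (simp add: has_pattern_def)
  then show ?thesis unfolding partition_regular_def by blast
qed

text \<open>Product coloring: \<open>x\<close> is colored by the whole block of \<open>f\<close> on
  \<open>x + S\<close>. There are finitely many blocks, so a pattern for this coloring makes entire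
  translates of \<open>S\<close> look alike.\<close>

lemma partition_regular_blocks:
  fixes k :: nat
  assumes "partition_regular A" "finite S"
  obtains S' N' where "finite S'"
    "\<And>f. (\<forall>x. f x < k) \<Longrightarrow>
      \<exists>b\<in>S'. \<exists>D\<in>{1..N'}. \<forall>p\<in>A. \<forall>s\<in>S. f (b + p D + s) = f (b + s)"
proof -
  let ?B = "S \<rightarrow>\<^sub>E {..<k}"
  have "finite ?B" using \<open>finite S\<close> by (simp add: finite_PiE)
  then obtain h k' where h: "h ` ?B = {i. i < (k'::nat)}" "inj_on h ?B"
    using finite_imp_inj_to_nat_seg[of ?B] by blast
  obtain S' N' where S': "finite S'" "\<And>f. (\<forall>x. f x < k') \<Longrightarrow> has_pattern S' N' A f"
    using assms(1) unfolding partition_regular_def by metis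
  show thesis
  proof (rule that[OF S'(1)])
    fix f :: "'a \<Rightarrow> nat" assume f: "\<forall>x. f x < k"
    define blk where "blk x = restrict (\<lambda>s. f (x + s)) S" for x
    have blk: "blk x \<in> ?B" for x using f by (auto simp: blk_def)
    then have "\<forall>x. h (blk x) < k'" using h(1) by auto
    then obtain b D where bD: "b \<in> S'" "D \<in> {1..N'}" "\<forall>p\<in>A. h (blk (b + p D)) = h (blk b)"
      using S'(2)[of "\<lambda>x. h (blk x)"] unfolding has_pattern_def by blast
    then have "\<forall>p\<in>A. blk (b + p D) = blk b" using h(2) blk by (meson inj_onD)
    then have "\<forall>p\<in>A. \<forall>s\<in>S. f (b + p D + s) = f (b + s)"
      unfolding blk_def by (metis restrict_apply')
    with bD show "\<exists>b\<in>S'. \<exists>D\<in>{1..N'}. \<forall>p\<in>A. \<forall>s\<in>S. f (b + p D + s) = f (b + s)" by blast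
  qed
qed

section \<open>Color focusing\<close>

text \<open>Induction on the number \<open>r\<close> of focused colors. The window for
  \<open>r\<close> is copied along a pattern of the maps in \<open>IH\<close>, the base point moves
  by \<open>- p1 D\<close>, and the color of the old base point joins the focused ones.
  \<open>N\<close> comes from the previous stage, so \<open>IH\<close> must cover every
  \<open>N\<close>.\<close>

lemma color_focusing:
  fixes A :: "(nat \<Rightarrow> 'a::ab_group_add) set"
  assumes "finite A" "p1 \<in> A" and zero: "\<And>p. p \<in> A \<Longrightarrow> p 0 = 0"
    and IH: "\<And>N. partition_regular ((\<lambda>(p, d) n. p (n + d) - p d - p1 n) ` (A \<times> {..N}))"
  shows "\<exists>S N. finite S \<and> (\<forall>f. (\<forall>x. f x < k) \<longrightarrow>
    has_pattern S N A f \<or> (\<exists>a C. C \<subseteq> {..<k} \<and> card C = r \<and> focused S N A f a C))"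
proof (induction r)
  case 0
  have "focused {0} 0 A f 0 {}" for f by (simp add: focused_def)
  then show ?case by (metis card.empty empty_subsetI finite.emptyI finite_insert)
next
  case (Suc r)
  then obtain S N where "finite S" and SN: "\<forall>f. (\<forall>x. f x < k) \<longrightarrow>
    has_pattern S N A f \<or> (\<exists>a C. C \<subseteq> {..<k} \<and> card C = r \<and> focused S N A f a C)"
    by (elim exE conjE)
  obtain S' N' where "finite S'" and S': "\<And>f. (\<forall>x. f x < k) \<Longrightarrow>
      \<exists>b\<in>S'. \<exists>D\<in>{1..N'}. \<forall>q\<in>(\<lambda>(p, d) n. p (n + d) - p d - p1 n) ` (A \<times> {..N}).
        \<forall>s\<in>S. f (b + q D + s) = f (b + s)"
    by (rule partition_regular_blocks[OF IH[of N] \<open>finite S\<close>, of k]) (rule that)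
  \<comment> \<open>In order: the base copy of the window, the moved base points, and the points
    that patterns from these reach. \<open>d\<close> starts at 0 to allow the difference
    \<open>D\<close> alone.\<close>
  define T where "T = (\<lambda>(b, s). b + s) ` (S' \<times> S) \<union>
    (\<lambda>(b, s, D). b + s - p1 D) ` (S' \<times> S \<times> {..N'}) \<union>
    (\<lambda>(b, s, D, p, d). b + s - p1 D + p (d + D)) ` (S' \<times> S \<times> {..N'} \<times> A \<times> {..N})"
  have "finite T"
    unfolding T_def using \<open>finite S\<close> \<open>finite S'\<close> \<open>finite A\<close>
    by (intro finite_UnI finite_imageI finite_cartesian_product) auto
  have T1: "b + s \<in> T" if "b \<in> S'" "s \<in> S" for b s using that unfolding T_def by force
  have T2: "b + s - p1 D \<in> T" if "b \<in> S'" "s \<in> S" "D \<le> N'" for b s D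
    using that unfolding T_def by force
  have T3: "b + s - p1 D + p (d + D) \<in> T"
    if "b \<in> S'" "s \<in> S" "D \<le> N'" "p \<in> A" "d \<le> N" for b s D p d
  proof -
    have "(b, s, D, p, d) \<in> S' \<times> S \<times> {..N'} \<times> A \<times> {..N}" using that by simp
    from imageI[OF this, of "\<lambda>(b, s, D, p, d). b + s - p1 D + p (d + D)"]
    show ?thesis unfolding T_def by simp
  qed
  have "has_pattern T (N + N') A f \<or>
      (\<exists>a C. C \<subseteq> {..<k} \<and> card C = Suc r \<and> focused T (N + N') A f a C)"
    if f: "\<forall>x. f x < k" for f
  proof -
    from S'[OF f] obtain b D where b: "b \<in> S'" and D: "D \<in> {1..N'}"
      and "\<forall>q\<in>(\<lambda>(p, d) n. p (n + d) - p d - p1 n) ` (A \<times> {..N}).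
        \<forall>s\<in>S. f (b + q D + s) = f (b + s)" by blast
    then have *: "f (b + (p (D + d) - p d - p1 D) + s) = f (b + s)"
      if "p \<in> A" "d \<le> N" "s \<in> S" for p d s using that by force
    have "\<forall>x. f (b + x) < k" using f by simp
    with SN consider "has_pattern S N A (\<lambda>x. f (b + x))"
      | a C where "C \<subseteq> {..<k}" "card C = r" "focused S N A (\<lambda>x. f (b + x)) a C" by metis
    then show ?thesis
    proof cases
      case 1
      then obtain a d where "a \<in> S" "d \<in> {1..N}"
        "\<forall>p\<in>A. a + p d \<in> S \<and> f (b + (a + p d)) = f (b + a)"
        unfolding has_pattern_def by blast
      then have "has_pattern T (N + N') A f"
        unfolding has_pattern_def using T1[OF b]
        by (intro bexI[of _ "b + a"] bexI[of _ d]) (auto simp: add.assoc)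
      then show ?thesis ..
    next
      case (2 a C)
      \<comment> \<open>Chosen so that
        \<open>a' + p (d + D) = b + (p (D + d) - p d - p1 D) + (a + p d)\<close>, the copy of the
        old pattern point \<open>a + p d\<close>.\<close>
      define a' where "a' = b + a - p1 D"
      define C' where "C' = insert (f (b + a)) C"
      have a: "a \<in> S" and fa: "f (b + a) \<notin> C"
        and C: "\<forall>c\<in>C. \<exists>d\<in>{1..N}. \<forall>p\<in>A. a + p d \<in> S \<and> f (b + (a + p d)) = c"
        using 2(3) by (auto simp: focused_def)
      have a': "a' \<in> T" using T2[OF b a] D by (simp add: a'_def)
      have "C' \<subseteq> {..<k}" using 2(1) f by (simp add: C'_def)
      have "card C' = Suc r"
        using 2(2) fa finite_subset[OF 2(1)] by (simp add: C'_def)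
      \<comment> \<open>The old differences are lengthened by \<open>D\<close>, and \<open>D\<close> itself is the new one.\<close>
      have C': "\<exists>d\<in>{1..N + N'}. \<forall>p\<in>A. a' + p d \<in> T \<and> f (a' + p d) = c" if "c \<in> C'" for c
      proof (cases "c \<in> C")
        case True
        with C obtain d where d: "d \<in> {1..N}" "\<forall>p\<in>A. a + p d \<in> S \<and> f (b + (a + p d)) = c"
          by blast
        have "f (a' + p (d + D)) = c" if "p \<in> A" for p
        proof -
          have "f (b + (p (D + d) - p d - p1 D) + (a + p d)) = f (b + (a + p d))"
            using d that by (intro *) auto
          moreover have "b + (p (D + d) - p d - p1 D) + (a + p d) = a' + p (d + D)"
            by (simp add: a'_def algebra_simps)
          ultimately show ?thesis using d that by simp
        qed
        moreover have "a' + p (d + D) \<in> T" if "p \<in> A" for p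
          using T3[OF b a _ that] d D by (simp add: a'_def)
        ultimately show ?thesis using d D by (intro bexI[of _ "d + D"]) auto
      next
        case False
        with that have c: "c = f (b + a)" by (simp add: C'_def)
        \<comment> \<open>For \<open>d = 0\<close>, where \<open>p 0 = 0\<close>, the available map
          is \<open>p - p1\<close>, so \<open>a' + p D\<close> is a copy of
          \<open>a\<close>.\<close>
        have "f (a' + p D) = c" if "p \<in> A" for p
          using *[OF that, of 0 a] zero[OF that] a by (simp add: a'_def c algebra_simps)
        moreover have "a' + p D \<in> T" if "p \<in> A" for p
          using T3[OF b a _ that, of D 0] D by (simp add: a'_def)
        ultimately show ?thesis using D by (intro bexI[of _ D]) auto
      qed
      show ?thesis
      proof (cases "f a' \<in> C'")
        case True
        from C'[OF this] a' have "has_pattern T (N + N') A f"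
          unfolding has_pattern_def by blast
        then show ?thesis ..
      next
        case False
        with a' C' have "focused T (N + N') A f a' C'" by (simp add: focused_def)
        with \<open>C' \<subseteq> {..<k}\<close> \<open>card C' = Suc r\<close> show ?thesis by blast
      qed
    qed
  qed
  with \<open>finite T\<close> show ?case by blast
qed

text \<open>For \<open>r = k\<close> the focused colors would exhaust all \<open>k\<close>, leaving
  none for the base point.\<close>

lemma partition_regular_step:
  fixes A :: "(nat \<Rightarrow> 'a::ab_group_add) set"
  assumes "finite A" "p1 \<in> A" "\<And>p. p \<in> A \<Longrightarrow> p 0 = 0"
    and "\<And>N. partition_regular ((\<lambda>(p, d) n. p (n + d) - p d - p1 n) ` (A \<times> {..N}))"
  shows "partition_regular A"
  unfolding partition_regular_def
proof
  fix k
  have "\<exists>S N. finite S \<and> (\<forall>f. (\<forall>x. f x < k) \<longrightarrow>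
    has_pattern S N A f \<or> (\<exists>a C. C \<subseteq> {..<k} \<and> card C = k \<and> focused S N A f a C))"
    by (rule color_focusing) fact+
  then obtain S N where "finite S" and
    SN: "\<And>f. (\<forall>x. f x < k) \<Longrightarrow>
      has_pattern S N A f \<or> (\<exists>a C. C \<subseteq> {..<k} \<and> card C = k \<and> focused S N A f a C)" by metis
  have "has_pattern S N A f" if f: "\<forall>x. f x < k" for f
  proof (rule ccontr)
    assume "\<not> has_pattern S N A f"
    with SN[OF f] obtain a C where "C \<subseteq> {..<k}" "card C = k" "focused S N A f a C" by blast
    moreover from this have "C = {..<k}" by (simp add: card_subset_eq)
    ultimately show False using f by (simp add: focused_def)
  qed
  with \<open>finite S\<close> show "\<exists>S N. finite S \<and> (\<forall>f. (\<forall>x. f x < k) \<longrightarrow> has_pattern S N A f)" by blast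
qed

section \<open>Exhaustion on the multiset of degrees\<close>

text \<open>A pair \<open>(q, e)\<close> stands for the maps of degree \<open>Suc e\<close> (not \<open>e\<close>) with the leading term of \<open>q\<close>.
  The degree of \<open>q\<close> itself may be smaller.\<close>

definition in_class :: "(nat \<Rightarrow> 'a::ab_group_add) \<Rightarrow> (nat \<Rightarrow> 'a) \<times> nat \<Rightarrow> bool" where
  "in_class p c \<longleftrightarrow> fst c \<in> poly_maps (Suc (snd c)) \<and> (\<lambda>n. p n - fst c n) \<in> poly_maps (snd c)"

text \<open>The polynomial exhaustion induction: subtracting a member \<open>p1\<close> of a class of lowest degree
  from all shifted maps translates the other classes and replaces that of \<open>p1\<close> by finitely many
  of lower degree, which decreases the multiset of degrees.\<close>

lemma partition_regular_if_classes:
  fixes A :: "(nat \<Rightarrow> 'a::ab_group_add) set"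
  assumes "finite A" "\<And>p. p \<in> A \<Longrightarrow> p 0 = 0" "\<forall>p\<in>A. \<exists>c\<in>#R. in_class p c"
  shows "partition_regular A"
proof -
  have wf: "wf (inv_image (mult less_than) (image_mset snd))"
    by (intro wf_inv_image wf_mult wf_less_than)
  show ?thesis
    using assms
  proof (induction R arbitrary: A rule: wf_induct_rule[OF wf])
    case (1 R A)
    \<comment> \<open>Classes without members in \<open>A\<close> are dropped first, so that a class
      of lowest degree supplies \<open>p1\<close>.\<close>
    consider "R = {#}" | c where "c \<in># R" "\<forall>p\<in>A. \<not> in_class p c"
      | "R \<noteq> {#}" "\<forall>c\<in>#R. \<exists>p\<in>A. in_class p c" by blast
    then show ?case
    proof cases
      case 1
      with \<open>\<forall>p\<in>A. \<exists>c\<in>#R. in_class p c\<close> have "A = {}" by auto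
      then show ?thesis by (simp add: partition_regular_empty)
    next
      case (2 c)
      obtain R0 where R: "R = add_mset c R0" using 2(1) by (metis mset_add)
      have "(image_mset snd R0 + {#}, image_mset snd R0 + {#snd c#}) \<in> mult less_than"
        by (rule one_step_implies_mult) auto
      then have "(R0, R) \<in> inv_image (mult less_than) (image_mset snd)"
        by (simp add: R)
      then show ?thesis
      proof (rule "1.IH")
        show "\<forall>p\<in>A. \<exists>c\<in>#R0. in_class p c"
          using "1.prems"(3) 2(2) unfolding R by auto
      qed (use "1.prems" in auto)
    next
      case 3
      \<comment> \<open>Minimality gives \<open>p1 \<in> poly_maps (Suc e)\<close> for every class
        \<open>(q, e)\<close>, so \<open>q - p1\<close> can represent a class with the same
        index.\<close>
      define e1 where "e1 = Min (snd ` set_mset R)"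
      have "e1 \<in> snd ` set_mset R" unfolding e1_def using 3(1) by (intro Min_in) auto
      then obtain q1 where q1: "(q1, e1) \<in># R" by auto
      have e1_le: "e1 \<le> e" if "(q, e) \<in># R" for q e
        unfolding e1_def using that by (intro Min_le) force+
      from 3(2) q1 obtain p1 where p1: "p1 \<in> A" "in_class p1 (q1, e1)" by blast
      obtain R0 where R: "R = add_mset (q1, e1) R0" using q1 by (metis mset_add)
      have p1': "p1 \<in> poly_maps (Suc e1)"
      proof -
        have "(\<lambda>n. (p1 n - q1 n) + q1 n) \<in> poly_maps (Suc e1)"
          by (rule poly_maps_add[OF poly_maps_Suc])
            (use p1(2) in \<open>auto simp: in_class_def simp del: poly_maps.simps\<close>)
        then show ?thesis by (simp del: poly_maps.simps)
      qed
      show ?thesis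
      proof (rule partition_regular_step)
        show "finite A" "p1 \<in> A" "\<And>p. p \<in> A \<Longrightarrow> p 0 = 0" by fact+
        fix N
        define B where "B = (\<lambda>(p, d) n. p (n + d) - p d - p1 n) ` (A \<times> {..N}) - {\<lambda>_. 0}"
        \<comment> \<open>Each new lower class is represented by its own member; index
          \<open>e1 - 1\<close> stands for degree \<open>e1\<close>. For \<open>e1 = 0\<close> there
          are none: a constant map vanishing at 0 is zero, which \<open>B\<close> excludes.\<close>
        define K where "K = (if e1 = 0 then {#} else
          image_mset (\<lambda>p. (p, e1 - 1)) (mset_set (B \<inter> poly_maps e1)))"
        define R' where "R' = image_mset (\<lambda>(q, e). (\<lambda>n. q n - p1 n, e)) R0 + K"
        have "finite B" unfolding B_def using "1.prems"(1) by simp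
        have B0: "q 0 = 0" if "q \<in> B" for q
          using that "1.prems"(2) p1(1) by (auto simp: B_def)
        have "partition_regular B"
        proof (rule "1.IH")
          show "finite B" "\<And>q. q \<in> B \<Longrightarrow> q 0 = 0" by fact+
          have snd_eq: "image_mset snd (image_mset (\<lambda>(q, e). (\<lambda>n. q n - p1 n, e)) R0) = image_mset snd R0"
            by (auto simp: multiset.map_comp intro!: image_mset_cong)
          have "(image_mset snd R0 + image_mset snd K, image_mset snd R0 + {#e1#}) \<in> mult less_than"
            by (rule one_step_implies_mult) (auto simp: K_def)
          then show "(R', R) \<in> inv_image (mult less_than) (image_mset snd)"
            by (simp add: R R'_def snd_eq)
          show "\<forall>p\<in>B. \<exists>c\<in>#R'. in_class p c"
          proof
            fix p' assume p': "p' \<in> B"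
            then obtain p d where p: "p \<in> A" and p'_eq: "p' = (\<lambda>n. p (n + d) - p d - p1 n)"
              by (auto simp: B_def)
            from "1.prems"(3) p obtain q e where qe: "(q, e) \<in># R" "in_class p (q, e)" by auto
            have q: "q \<in> poly_maps (Suc e)" and pq: "(\<lambda>n. p n - q n) \<in> poly_maps e"
              using qe(2) by (auto simp: in_class_def)
            have "(\<lambda>n. (p n - q n) + q n) \<in> poly_maps (Suc e)"
              by (rule poly_maps_add[OF poly_maps_Suc[OF pq] q])
            then have "p \<in> poly_maps (Suc e)" by (simp del: poly_maps.simps)
            \<comment> \<open>Shifting the argument and subtracting constants affects only lower
              terms, so \<open>p'\<close> has the leading term of \<open>q - p1\<close>.\<close>
            have "(\<lambda>n. (p (n + d) - p n) - p d + (p n - q n)) \<in> poly_maps e"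
              by (intro poly_maps_add poly_maps_diff poly_maps_increment poly_maps_const pq) fact
            moreover have "(\<lambda>n. (p (n + d) - p n) - p d + (p n - q n)) = (\<lambda>n. p' n - (q n - p1 n))"
              by (simp add: p'_eq algebra_simps)
            ultimately have diff: "(\<lambda>n. p' n - (q n - p1 n)) \<in> poly_maps e" by simp
            show "\<exists>c\<in>#R'. in_class p' c"
            proof (cases "(q, e) \<in># R0")
              case True
              then have "(\<lambda>n. q n - p1 n, e) \<in># R'" by (force simp: R'_def)
              moreover have "p1 \<in> poly_maps (Suc e)"
                using e1_le[OF qe(1)] by (intro poly_maps_mono[OF p1']) simp
              then have "(\<lambda>n. q n - p1 n) \<in> poly_maps (Suc e)" by (rule poly_maps_diff[OF q])
              ultimately show ?thesis
                using diff by (intro bexI[of _ "(\<lambda>n. q n - p1 n, e)"]) (simp_all add: in_class_def)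
            next
              case False
              with qe(1) have [simp]: "q = q1" "e = e1" by (auto simp: R)
              \<comment> \<open>Here \<open>q1 - p1\<close> itself has degree at most
                \<open>e1\<close>: the leading terms cancel.\<close>
              have "(\<lambda>n. (p' n - (q1 n - p1 n)) - (p1 n - q1 n)) \<in> poly_maps e1"
                by (rule poly_maps_diff) (use diff p1(2) in \<open>auto simp: in_class_def\<close>)
              then have low: "p' \<in> poly_maps e1" by simp
              show ?thesis
              proof (cases e1)
                case 0
                then have "p' = (\<lambda>_. 0)" using low B0[OF p'] by auto
                then show ?thesis using p' by (auto simp: B_def)
              next
                case (Suc e')
                then have "(p', e') \<in># R'" using low p' \<open>finite B\<close>
                  by (simp add: R'_def K_def)
                moreover have "in_class p' (p', e')"
                  using low poly_maps_const[of 0 e'] by (simp add: in_class_def Suc)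
                ultimately show ?thesis by blast
              qed
            qed
          qed
        qed
        then show "partition_regular ((\<lambda>(p, d) n. p (n + d) - p d - p1 n) ` (A \<times> {..N}))"
          unfolding B_def by (rule partition_regular_insert_zero)
      qed
    qed
  qed
qed

text \<open>Each map starts as its own class; a class only needs an upper bound on the degree, so
  \<open>Suc e\<close> serves for all.\<close>

theorem polynomial_van_der_Waerden:
  fixes A :: "(nat \<Rightarrow> 'a::ab_group_add) set"
  assumes "finite A" "\<And>p. p \<in> A \<Longrightarrow> p 0 = 0" "A \<subseteq> poly_maps e"
  shows "partition_regular A"
proof (rule partition_regular_if_classes)
  show "finite A" "\<And>p. p \<in> A \<Longrightarrow> p 0 = 0" by fact+
  have "in_class p (p, e)" if "p \<in> A" for p
    using assms(3) that poly_maps_Suc[of p e] poly_maps_const[of 0 e]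
    by (auto simp: in_class_def simp del: poly_maps.simps)
  then show "\<forall>p\<in>A. \<exists>c\<in>#image_mset (\<lambda>p. (p, e)) (mset_set A). in_class p c"
    using assms(1) by auto
qed

section \<open>Sums of two squares and their enumeration\<close>

text \<open>The Brahmagupta-Fibonacci identity; the absolute value handles a negative difference of
  products.\<close>

lemma sums_two_squares_mult:
  assumes "x \<in> sums_two_squares" "y \<in> sums_two_squares"
  shows "x * y \<in> sums_two_squares"
proof -
  obtain u v u' v' where x: "x = u^2 + v^2" and y: "y = u'^2 + v'^2"
    using assms by (auto simp: sums_two_squares_def)
  define w where "w = nat \<bar>int u * u' - int v * v'\<bar>"
  define z where "z = u * v' + v * u'"
  have "int (x * y) = int (w^2 + z^2)"
    by (simp add: x y w_def z_def power2_eq_square algebra_simps)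
  then have "x * y = w^2 + z^2" by linarith
  then show ?thesis by (auto simp: sums_two_squares_def)
qed

lemma sums_two_squares_1: "1 \<in> sums_two_squares"
proof -
  have "(1::nat) = 1^2 + 0^2" by simp
  then show ?thesis unfolding sums_two_squares_def by blast
qed

lemma sums_two_squares_power: "x \<in> sums_two_squares \<Longrightarrow> x ^ n \<in> sums_two_squares"
  by (induction n) (auto simp: sums_two_squares_mult sums_two_squares_1 simp del: One_nat_def)

lemma sums_two_squares_prod:
  "(\<And>i. i \<in> I \<Longrightarrow> g i \<in> sums_two_squares) \<Longrightarrow> prod g I \<in> sums_two_squares"
  by (induction I rule: infinite_finite_induct)
    (auto simp: sums_two_squares_mult sums_two_squares_1 simp del: One_nat_def)

lemma sq_seq_in: "sq_seq n \<in> sums_two_squares"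
  using range_sq_seq by auto

lemma sq_seq_pos: "0 < n \<Longrightarrow> 0 < sq_seq n"
  using strict_monoD[OF strict_mono_sq_seq, of 0 n] by simp

lemma sq_seq_0: "sq_seq 0 = 0"
proof -
  have "(0::nat) = 0^2 + 0^2" by simp
  then have "0 \<in> sums_two_squares" unfolding sums_two_squares_def by blast
  then obtain n where "sq_seq n = 0" using range_sq_seq by (metis imageE)
  then show ?thesis using sq_seq_pos[of n] by (cases n) auto
qed

lemma ex_sq_seq_pos:
  assumes "x \<in> sums_two_squares" "0 < x"
  obtains m where "1 \<le> m" "sq_seq m = x"
proof -
  obtain m where "sq_seq m = x" using assms range_sq_seq by (metis imageE)
  with assms sq_seq_0 that show thesis by (cases m) auto
qed

text \<open>Witnessed by 0, itself a sum of two squares. This keeps the cardinalities among the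
  positive integers, where the coloring is controlled.\<close>

lemma card_below_pos:
  assumes "0 < x" shows "1 \<le> card (sums_two_squares_below x)"
proof -
  have "0 \<in> sums_two_squares_below x"
    using assms sq_seq_in[of 0] by (simp add: sq_seq_0 sums_two_squares_below_def)
  moreover have "finite (sums_two_squares_below x)"
    by (rule finite_subset[of _ "{..<x}"]) (auto simp: sums_two_squares_below_def)
  ultimately show ?thesis by (metis One_nat_def Suc_leI card_gt_0_iff empty_iff)
qed

section \<open>Exponent vectors and the pulled-back coloring\<close>

theorem theorem5p7:
  fixes d k l :: nat
    and F :: "nat \<Rightarrow> nat set"
    and a :: "nat \<Rightarrow> nat \<Rightarrow> nat"
    and \<chi> :: "nat \<Rightarrow> nat"
  assumes "1 \<le> d" and "1 \<le> k" and "1 \<le> l"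
    and "F ` {1..l} \<subseteq> Pf"
    and "\<And>i. i \<in> {1..l} \<Longrightarrow> F i = a i ` {1..d}"
    and "coloring k \<chi>"
  shows "\<exists>b\<ge>1. \<exists>c\<ge>1.
    monochromatic k \<chi>
      ((\<lambda>i. card (sums_two_squares_below (sq_seq b * (\<Prod>j=1..d. sq_seq (a i j) ^ (c ^ j))))) ` {1..l})"
proof -
  \<comment> \<open>The exponent vector of the \<open>i\<close>-th factor: its entry at
    \<open>u\<close> is the exponent of \<open>sq_seq u\<close>. Repeated indices add up.\<close>
  define P :: "nat \<Rightarrow> nat \<Rightarrow> nat \<Rightarrow> int" where
    "P i n = (\<Sum>j=1..d. of_nat n ^ j * (\<lambda>u. of_bool (u = a i j)))" for i n
  have power_apply: "((of_nat n :: nat \<Rightarrow> int) ^ j) u = int n ^ j" for n j u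
    by (induction j) (simp_all add: of_nat_fun)
  have sum_apply: "(\<Sum>j\<in>J. g j) u = (\<Sum>j\<in>J. g j u)" for J and g :: "nat \<Rightarrow> nat \<Rightarrow> int" and u
    by (induction J rule: infinite_finite_induct) simp_all
  have P_apply: "P i n u = int (\<Sum>j=1..d. if u = a i j then n ^ j else 0)" for i n u
    unfolding P_def sum_apply of_nat_sum by (intro sum.cong refl) (simp add: power_apply)
  have apos: "0 < a i j" if "i \<in> {1..l}" "j \<in> {1..d}" for i j
    using assms(4) assms(5)[OF that(1)] that by (force simp: Pf_def)
  define U where "U = (\<Union>i\<in>{1..l}. a i ` {1..d})"
  have "finite U" by (simp add: U_def)
  have Upos: "0 < sq_seq u" if "u \<in> U" for u
    using that apos sq_seq_pos by (auto simp: U_def)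
  \<comment> \<open>\<open>nat\<close> truncates negative entries, so turning sums into products is
    claimed in \<open>G_add\<close> only for \<open>x\<close> nonnegative on
    \<open>U\<close>.\<close>
  define G where "G x = (\<Prod>u\<in>U. sq_seq u ^ nat (x u))" for x :: "nat \<Rightarrow> int"
  have G_in: "G x \<in> sums_two_squares" for x
    unfolding G_def by (intro sums_two_squares_prod sums_two_squares_power sq_seq_in)
  have G_pos: "0 < G x" for x
    unfolding G_def using Upos by (intro prod_pos) auto
  have G_add: "G (x + P i c) = G x * (\<Prod>j=1..d. sq_seq (a i j) ^ (c ^ j))"
    if x: "\<And>u. u \<in> U \<Longrightarrow> 0 \<le> x u" and i: "i \<in> {1..l}" for x i c
  proof -
    have "G (x + P i c) = (\<Prod>u\<in>U. sq_seq u ^ nat (x u) * sq_seq u ^ (\<Sum>j=1..d. if u = a i j then c ^ j else 0))"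
      unfolding G_def using x
      by (intro prod.cong refl) (simp only: plus_fun_apply P_apply nat_add_distrib of_nat_0_le_iff nat_int power_add)
    also have "\<dots> = G x * (\<Prod>u\<in>U. \<Prod>j=1..d. sq_seq u ^ (if u = a i j then c ^ j else 0))"
      by (simp add: prod.distrib G_def power_sum)
    also have "(\<Prod>u\<in>U. \<Prod>j=1..d. sq_seq u ^ (if u = a i j then c ^ j else 0))
        = (\<Prod>j=1..d. \<Prod>u\<in>U. sq_seq u ^ (if u = a i j then c ^ j else 0))"
      by (rule prod.swap)
    also have "\<dots> = (\<Prod>j=1..d. sq_seq (a i j) ^ (c ^ j))"
    proof (rule prod.cong[OF refl])
      fix j assume "j \<in> {1..d}"
      then have "a i j \<in> U" using i unfolding U_def by blast
      have "(\<Prod>u\<in>U. sq_seq u ^ (if u = a i j then c ^ j else 0))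
          = (\<Prod>u\<in>U. if u = a i j then sq_seq u ^ (c ^ j) else 1)"
        by (intro prod.cong) auto
      then show "(\<Prod>u\<in>U. sq_seq u ^ (if u = a i j then c ^ j else 0)) = sq_seq (a i j) ^ (c ^ j)"
        using \<open>finite U\<close> \<open>a i j \<in> U\<close> by (simp add: prod.delta)
    qed
    finally show ?thesis .
  qed
  define idx where "idx x = card (sums_two_squares_below x)" for x
  have chi: "\<chi> (idx (G x)) \<in> {1..k}" for x
    using assms(6) card_below_pos[OF G_pos] by (auto simp: coloring_def idx_def)
  have "partition_regular (P ` {1..l})"
  proof (rule polynomial_van_der_Waerden)
    show "P ` {1..l} \<subseteq> poly_maps d"
    proof
      fix p assume "p \<in> P ` {1..l}"
      then obtain i where "p = P i" by blast
      moreover have "P i = (\<lambda>n. \<Sum>j=1..d. of_nat n ^ j * (\<lambda>u. of_bool (u = a i j)))"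
        by (simp add: P_def fun_eq_iff)
      moreover have "\<dots> \<in> poly_maps d"
        by (intro poly_maps_sum poly_maps_mono[OF poly_maps_monomial]) auto
      ultimately show "p \<in> poly_maps d" by simp
    qed
    \<comment> \<open>The powers start at \<open>j = 1\<close>, so there is no constant
      term.\<close>
    have "(\<Sum>j=1..d. if u = a i j then 0 ^ j else 0) = (0::nat)" for i u
      by (intro sum.neutral) auto
    then have "P i 0 = 0" for i by (intro ext) (simp only: P_apply zero_fun_apply of_nat_0)
    then show "p 0 = 0" if "p \<in> P ` {1..l}" for p using that by blast
  qed simp
  \<comment> \<open>The colors 1 to \<open>k\<close> lie below \<open>Suc k\<close>.\<close>
  then obtain S N where "finite S" and
    S: "\<And>f. (\<forall>x. f x < Suc k) \<Longrightarrow> has_pattern S N (P ` {1..l}) f"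
    unfolding partition_regular_def by metis
  \<comment> \<open>A translation making all entries on \<open>U\<close> of vectors in
    \<open>S\<close> nonnegative. It can enter the definition of \<open>f\<close> because
    \<open>S\<close> is fixed before the coloring.\<close>
  define T where "T = (\<Sum>x\<in>S. \<Sum>u\<in>U. \<bar>x u\<bar>)"
  have T: "0 \<le> x u + T" if "x \<in> S" "u \<in> U" for x u
  proof -
    have "\<bar>x u\<bar> \<le> (\<Sum>u\<in>U. \<bar>x u\<bar>)" using \<open>finite U\<close> that by (intro member_le_sum) auto
    also have "\<dots> \<le> T" unfolding T_def
      using \<open>finite S\<close> that by (intro member_le_sum[of x S "\<lambda>x. \<Sum>u\<in>U. \<bar>x u\<bar>"]) (auto intro: sum_nonneg)
    finally show ?thesis by linarith
  qed
  define f where "f x = \<chi> (idx (G (x + (\<lambda>_. T))))" for x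
  have "\<forall>x. f x < Suc k" unfolding f_def using chi by (simp add: less_Suc_eq_le)
  from S[OF this] obtain x c where x: "x \<in> S" and c: "1 \<le> c"
    and mono: "\<And>i. i \<in> {1..l} \<Longrightarrow> f (x + P i c) = f x"
    unfolding has_pattern_def by auto
  define y where "y = x + (\<lambda>_. T)"
  have y: "0 \<le> y u" if "u \<in> U" for u using T[OF x that] by (simp add: y_def)
  obtain b where b: "1 \<le> b" "sq_seq b = G y" using ex_sq_seq_pos[OF G_in G_pos] .
  have "idx (sq_seq b * (\<Prod>j=1..d. sq_seq (a i j) ^ (c ^ j))) \<in> color_class \<chi> (f x)"
    if i: "i \<in> {1..l}" for i
  proof -
    have "sq_seq b * (\<Prod>j=1..d. sq_seq (a i j) ^ (c ^ j)) = G (x + P i c + (\<lambda>_. T))"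
      using G_add[of y i c, OF y i] b by (simp add: y_def ac_simps)
    then show ?thesis
      using mono[OF i] card_below_pos[OF G_pos] by (simp add: color_class_def f_def idx_def)
  qed
  then have "monochromatic k \<chi> ((\<lambda>i. idx (sq_seq b * (\<Prod>j=1..d. sq_seq (a i j) ^ (c ^ j)))) ` {1..l})"
    unfolding monochromatic_def using chi by (intro bexI[of _ "f x"]) (auto simp: f_def)
  with b(1) c show ?thesis unfolding idx_def by blast
qed

end
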